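(* Let $q_0\in(0,1)$, $\lambda>0$ and $q(\theta)=q_0+\lambda\theta$, and consider the deterministic and stochastic Boltzmann-type models on $\mathbb{R}$ for the symmetric aggregation/consensus interactions with coefficient $q(\theta)$, with the same initial distribution (independent of $\theta$) for $g$ and $f$, having zero mean and $E_g(0)=E_f(0;\theta)=1$ for all $\theta\in I_\Theta$. (i) Suppose that the law of $\theta$ is symmetric about $0$ (hence has zero mean), with $0<\operatorname{Var}(\theta)<+\infty$. Then for all $t\ge0$ and $\theta\in I_\Theta$ $$E_g(t)=e^{2\left(q_0^2-q_0+\lambda^2\operatorname{Var}(\theta)\right)t},\qquad E_f(t;\theta)=e^{2\left(q_0^2-q_0+\lambda^2\theta^2+\lambda(2q_0-1)\theta\right)t},$$ and the deterministic model leads to aggregation/consensus, i.e. $\lim_{t\to+\infty}W_2(g(t),\delta_0)=0$, if $$0<\lambda<\sqrt{\frac{q_0(1-q_0)}{\operatorname{Var}(\theta)}} .$$ (ii) Suppose that $\theta$ is uniformly distributed in $I_\Theta=[-1,1]$. If $$0<\lambda\le\min\{q_0,\,1-q_0\},$$ then $E_{\bar f}(t)\to0$ as $t\to+\infty$, so that the stochastic model leads to aggregation/consensus, i.e. $\lim_{t\to+\infty}W_2(\bar f(t),\delta_0)=0$. (iii) Suppose that $\theta$ is uniformly distributed in $I_\Theta=[-1,1]$ (so $\operatorname{Var}(\theta)=\frac13$). Then there is a function $C(t)$ converging to a non-zero finite value as $t\to+\infty$ such that $$\frac{E_{\bar f}(t)}{E_g(t)}\sim\frac{C(t)}{t}\,e^{2\left(\frac23\lambda^2+\lambda|2q_0-1|\right)t}\qquad(t\to+\infty);$$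 in particular $E_g(t)=o(E_{\bar f}(t))$ as $t\to+\infty$.
   Context: Binary interactions: for $v,w\in\mathbb{R}$, $$v^\ast=v+q(\theta)(w-v),\qquad w^\ast=w+q(\theta)(v-w),$$ where $\theta$ is a real random variable with values in $I_\Theta\subseteq\mathbb{R}$ and probability density $\rho$. Deterministic model: $g(t,\cdot)$ is a probability density on $\mathbb{R}$ for each $t\ge0$ such that, for test functions $\varphi$, $$\frac{d}{dt}\int_{\mathbb{R}}\varphi(v)g(t,v)\,dv=\frac12\iint_{\mathbb{R}^2}\int_{I_\Theta}\big(\varphi(v^\ast)+\varphi(w^\ast)-\varphi(v)-\varphi(w)\big)\rho(\theta)g(t,v)g(t,w)\,d\theta\,dv\,dw .$$ Stochastic model: for each $\theta\in I_\Theta$, $f(t,\cdot;\theta)$ is a probability density on $\mathbb{R}$ for each $t\ge0$ such that, for test functions $\varphi$, $$\frac{d}{dt}\int_{\mathbb{R}}\varphi(v)f(t,v;\theta)\,dv=\frac12\iint_{\mathbb{R}^2}\big(\varphi(v^\ast)+\varphi(w^\ast)-\varphi(v)-\varphi(w)\big)f(t,v;\theta)f(t,w;\theta)\,dv\,dw .$$ It is assumed that second moments in $v$ are finite for all $t\ge 0$ and that $\varphi(v)=v$ and $\varphi(v)=v^2$ are admissible test functions. Notation: $E_g(t)=\int_{\mathbb{R}}v^2g(t,v)\,dv$, $E_f(t;\theta)=\int_{\mathbb{R}}v^2f(t,v;\theta)\,dv$, $\bar f(t,v)=\int_{I_\Theta}f(t,v;\theta)\rho(\theta)\,d\theta$,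 $E_{\bar f}(t)=\int_{\mathbb{R}}v^2\bar f(t,v)\,dv=\int_{I_\Theta}E_f(t;\theta)\rho(\theta)\,d\theta$. $W_2$ is the $2$-Wasserstein distance between probability measures on $\mathbb{R}$ and $\delta_0$ is the Dirac measure at $v=0$. For functions of $t$, $a\sim b$ means $a(t)/b(t)\to1$ as $t\to+\infty$. *)

theory Defs
  imports "HOL-Probability.Probability" "HOL-Library.Landau_Symbols"
begin

definition prob_density :: "(real \<Rightarrow> real) \<Rightarrow> bool" where
  "prob_density p \<longleftrightarrow>
     p \<in> borel_measurable borel \<and> (\<forall>x. 0 \<le> p x) \<and>
     prob_space (density lborel (\<lambda>x. ennreal (p x)))"

definition law :: "(real \<Rightarrow> real) \<Rightarrow> real measure" where
  "law p = density lborel (\<lambda>x. ennreal (p x))"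

definition mean_value :: "(real \<Rightarrow> real) \<Rightarrow> real" where
  "mean_value p = (\<integral>v. v * p v \<partial>lborel)"

definition energy :: "(real \<Rightarrow> real) \<Rightarrow> real" where
  "energy p = (\<integral>v. v\<^sup>2 * p v \<partial>lborel)"

text \<open>
  The post-interaction state of the particle in state \<open>v\<close> meeting one in state \<open>w\<close>:
  \<open>v\<^sup>* = post k v w\<close> and \<open>w\<^sup>* = post k w v\<close>.
\<close>

definition post :: "real \<Rightarrow> real \<Rightarrow> real \<Rightarrow> real" where
  "post k v w = v + k * (w - v)"

definition collision_gain :: "(real \<Rightarrow> real) \<Rightarrow> real \<Rightarrow> real \<Rightarrow> real \<Rightarrow> real" where
  "collision_gain \<phi> k v w = \<phi> (post k v w) + \<phi> (post k w v) - \<phi> v - \<phi> w"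

text \<open>
  Both models are in weak form with respect to a class \<open>\<Phi>\<close> of test functions.  The Bochner
  integral of a non-integrable function is \<open>0\<close>, so the integrability that gives the
  weak equations a meaning is part of the definitions.  Only times \<open>t \<ge> 0\<close> matter; the time
  derivative at \<open>t = 0\<close> is one-sided.
\<close>

definition deterministic_model ::
  "(real \<Rightarrow> real) set \<Rightarrow> (real \<Rightarrow> real) \<Rightarrow> real set \<Rightarrow> (real \<Rightarrow> real) \<Rightarrow> (real \<Rightarrow> real \<Rightarrow> real) \<Rightarrow> bool"
where
  "deterministic_model \<Phi> q I \<rho> g \<longleftrightarrow>
     (\<forall>t\<ge>0. prob_density (g t) \<and> integrable lborel (\<lambda>v. v\<^sup>2 * g t v)) \<and>
     (\<forall>\<phi>\<in>\<Phi>. \<forall>t\<ge>0.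
        integrable lborel (\<lambda>v. \<phi> v * g t v) \<and>
        set_integrable lborel (UNIV \<times> UNIV \<times> I)
          (\<lambda>(v, w, \<theta>). collision_gain \<phi> (q \<theta>) v w * \<rho> \<theta> * g t v * g t w) \<and>
        ((\<lambda>s. \<integral>v. \<phi> v * g s v \<partial>lborel) has_real_derivative
           1 / 2 * (\<integral>v. (\<integral>w. (LINT \<theta>:I|lborel.
              collision_gain \<phi> (q \<theta>) v w * \<rho> \<theta> * g t v * g t w) \<partial>lborel) \<partial>lborel))
          (at t within {0..}))"

text \<open>
  The argument order is \<open>f t v \<theta>\<close>.  Joint measurability in \<open>(v, \<theta>)\<close> is what the
  \<open>\<theta>\<close>-average of \<open>f\<close> below needs in order to be a density.
\<close>

definition stochastic_model ::
  "(real \<Rightarrow> real) set \<Rightarrow> (real \<Rightarrow> real) \<Rightarrow> real set \<Rightarrow> (real \<Rightarrow> real \<Rightarrow> real \<Rightarrow> real) \<Rightarrow> bool"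
where
  "stochastic_model \<Phi> q I f \<longleftrightarrow>
     (\<forall>t\<ge>0. set_borel_measurable borel (UNIV \<times> I) (\<lambda>(v, \<theta>). f t v \<theta>)) \<and>
     (\<forall>\<theta>\<in>I. \<forall>t\<ge>0. prob_density (\<lambda>v. f t v \<theta>) \<and> integrable lborel (\<lambda>v. v\<^sup>2 * f t v \<theta>)) \<and>
     (\<forall>\<theta>\<in>I. \<forall>\<phi>\<in>\<Phi>. \<forall>t\<ge>0.
        integrable lborel (\<lambda>v. \<phi> v * f t v \<theta>) \<and>
        integrable lborel (\<lambda>(v, w). collision_gain \<phi> (q \<theta>) v w * f t v \<theta> * f t w \<theta>) \<and>
        ((\<lambda>s. \<integral>v. \<phi> v * f s v \<theta> \<partial>lborel) has_real_derivative
           1 / 2 * (\<integral>v. (\<integral>w.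
              collision_gain \<phi> (q \<theta>) v w * f t v \<theta> * f t w \<theta> \<partial>lborel) \<partial>lborel))
          (at t within {0..}))"

definition averaged ::
  "real set \<Rightarrow> (real \<Rightarrow> real) \<Rightarrow> (real \<Rightarrow> real \<Rightarrow> real \<Rightarrow> real) \<Rightarrow> real \<Rightarrow> real \<Rightarrow> real" where
  "averaged I \<rho> f t v = (LINT \<theta>:I|lborel. f t v \<theta> * \<rho> \<theta>)"

definition couplings :: "real measure \<Rightarrow> real measure \<Rightarrow> (real \<times> real) measure set" where
  "couplings \<mu> \<nu> = {\<pi>. prob_space \<pi> \<and> sets \<pi> = sets (borel \<Otimes>\<^sub>M borel) \<and>
     distr \<pi> borel fst = \<mu> \<and> distr \<pi> borel snd = \<nu>}"

definition ennreal_sqrt :: "ennreal \<Rightarrow> ennreal" where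
  "ennreal_sqrt x = (if x = \<infinity> then \<infinity> else ennreal (sqrt (enn2real x)))"

text \<open>
  The distance is extended-valued: it is infinite when no coupling has finite cost.
\<close>

definition W2 :: "real measure \<Rightarrow> real measure \<Rightarrow> ennreal" where
  "W2 \<mu> \<nu> = ennreal_sqrt
     (INF \<pi>\<in>couplings \<mu> \<nu>. \<integral>\<^sup>+ z. ennreal (\<bar>fst z - snd z\<bar>\<^sup>2) \<partial>\<pi>)"

end

(*
  The collision gain of v^2 is 2 (k^2 - k) (v - w)^2 and that of v is 0, so with zero mean both
  energies solve linear ODEs E' = 2 K E, where K = E[q^2 - q] for g and K = q(theta)^2 - q(theta)
  for f.  Coupling a law with delta_0 through v |-> (v, 0) shows that W_2 is at most the square
  root of the energy.  For uniform theta, Tonelli turns the averaged energy into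
  half the integral over [-1,1] of the exponential of a convex quadratic in theta, whose mass
  concentrates at the endpoints: Laplace's method gives the rate C(t)/t times the exponential at
  the larger endpoint value.  Under the hypothesis of (ii) that value is q (q - 1) for some
  q in [0,1], hence nonpositive, so the 1/t factor alone forces decay.
*)
theory Submission
  imports Defs "HOL-Real_Asymp.Real_Asymp"
begin

section \<open>Collision gains and probability densities\<close>

lemma collision_gain_id: "collision_gain (\<lambda>v. v) k v w = 0"
  by (simp add: collision_gain_def post_def algebra_simps)

lemma collision_gain_square: "collision_gain (\<lambda>v. v\<^sup>2) k v w = 2 * (k\<^sup>2 - k) * (v - w)\<^sup>2"
  by (simp add: collision_gain_def post_def algebra_simps power2_eq_square)

lemma prob_densityD:
  assumes "prob_density p"
  shows "p \<in> borel_measurable borel" "\<And>x. 0 \<le> p x" "integrable lborel p" "(\<integral>x. p x \<partial>lborel) = 1"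
proof -
  show m: "p \<in> borel_measurable borel" and nn: "\<And>x. 0 \<le> p x"
    using assms by (auto simp: prob_density_def)
  interpret prob_space "density lborel (\<lambda>x. ennreal (p x))"
    using assms by (simp add: prob_density_def)
  have "emeasure (density lborel (\<lambda>x. ennreal (p x))) UNIV = 1"
    using emeasure_space_1 by simp
  then have *: "(\<integral>\<^sup>+ x. ennreal (p x) \<partial>lborel) = 1"
    using m by (simp add: emeasure_density)
  then show "integrable lborel p"
    using m nn by (intro integrableI_nonneg) auto
  show "(\<integral>x. p x \<partial>lborel) = 1"
    using m nn * by (subst integral_eq_nn_integral) auto
qed

lemma prob_densityI:
  assumes "p \<in> borel_measurable borel" "\<And>x. 0 \<le> p x" "integrable lborel p" "(\<integral>x. p x \<partial>lborel) = 1"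
  shows "prob_density p"
proof -
  have "(\<integral>\<^sup>+ x. ennreal (p x) \<partial>lborel) = ennreal 1"
    using assms by (subst nn_integral_eq_integral) auto
  then show ?thesis
    using assms unfolding prob_density_def
    by (auto intro!: prob_spaceI simp: emeasure_density)
qed

section \<open>Evolution of mean and energy\<close>

text \<open>For independent \<open>v\<close> and \<open>w\<close> with density \<open>p\<close>, the
  second moment of \<open>v - w\<close> is twice the variance. This closes the energy equation: the
  right-hand side involves no moments beyond the mean and the energy itself.\<close>

lemma double_integral_square_diff:
  fixes p :: "real \<Rightarrow> real"
  assumes p: "prob_density p"
    and p1: "integrable lborel (\<lambda>v. v * p v)" and p2: "integrable lborel (\<lambda>v. v\<^sup>2 * p v)"
  shows "(\<integral>v. (\<integral>w. K * (v - w)\<^sup>2 * p v * p w \<partial>lborel) \<partial>lborel)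
    = 2 * K * (energy p - (mean_value p)\<^sup>2)"
proof -
  note p0 = prob_densityD(3)[OF p] and pi = prob_densityD(4)[OF p]
  have inner: "(\<integral>w. K * (v - w)\<^sup>2 * p v * p w \<partial>lborel)
      = K * (v\<^sup>2 * p v - 2 * mean_value p * (v * p v) + energy p * p v)" for v
  proof -
    have "(\<integral>w. K * (v - w)\<^sup>2 * p v * p w \<partial>lborel)
        = (\<integral>w. (K * p v * v\<^sup>2) * p w + (- 2 * K * p v * v) * (w * p w) + (K * p v) * (w\<^sup>2 * p w) \<partial>lborel)"
      by (rule Bochner_Integration.integral_cong) (auto simp: power2_eq_square algebra_simps)
    also have "\<dots> = (K * p v * v\<^sup>2) * (\<integral>w. p w \<partial>lborel) + (- 2 * K * p v * v) * (\<integral>w. w * p w \<partial>lborel)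
        + (K * p v) * (\<integral>w. w\<^sup>2 * p w \<partial>lborel)"
      using p0 p1 p2 by (subst Bochner_Integration.integral_add | intro Bochner_Integration.integrable_add integrable_mult_right
        | simp only: integral_mult_right_zero | assumption)+
    finally show ?thesis
      by (simp add: pi mean_value_def energy_def algebra_simps)
  qed
  have "(\<integral>v. v\<^sup>2 * p v - 2 * mean_value p * (v * p v) + energy p * p v \<partial>lborel)
      = (\<integral>v. v\<^sup>2 * p v \<partial>lborel) - 2 * mean_value p * (\<integral>v. v * p v \<partial>lborel) + energy p * (\<integral>v. p v \<partial>lborel)"
    using p0 p1 p2
    by (subst Bochner_Integration.integral_add | subst Bochner_Integration.integral_diff
        | intro Bochner_Integration.integrable_add Bochner_Integration.integrable_diff integrable_mult_right
        | simp only: integral_mult_right_zero | assumption)+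
  also have "\<dots> = 2 * (energy p - (mean_value p)\<^sup>2)"
    by (simp add: pi power2_eq_square[of "mean_value p"] flip: mean_value_def energy_def)
  finally show ?thesis
    unfolding inner integral_mult_right_zero by simp
qed

text \<open>Multiplying by the integrating factor \<open>exp (- c * t)\<close> gives a function with
  zero derivative on the convex set \<open>{0..}\<close>, hence a constant. The derivative is taken
  within \<open>{0..}\<close>, one-sided at \<open>0\<close> as in the models.\<close>

lemma linear_ode_unique:
  fixes E :: "real \<Rightarrow> real"
  assumes E: "\<And>t. 0 \<le> t \<Longrightarrow> (E has_real_derivative c * E t) (at t within {0..})" and "0 \<le> t"
  shows "E t = E 0 * exp (c * t)"
proof -
  have "((\<lambda>s. E s * exp (- c * s)) has_real_derivative 0) (at s within {0..})" if "s \<in> {0..}" for s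
    using that by (auto intro!: derivative_eq_intros E)
  then obtain k where k: "\<And>s. s \<in> {0..} \<Longrightarrow> E s * exp (- c * s) = k"
    using has_field_derivative_zero_constant[of "{0::real..}" "\<lambda>s. E s * exp (- c * s)"] by auto
  have "E t * exp (- c * t) = E 0"
    using k[of t] k[of 0] \<open>0 \<le> t\<close> by simp
  then show ?thesis
    by (simp add: exp_minus field_simps)
qed

lemma mean_conserved:
  fixes h :: "real \<Rightarrow> real \<Rightarrow> real"
  assumes "\<And>t. 0 \<le> t \<Longrightarrow> ((\<lambda>s. \<integral>v. v * h s v \<partial>lborel) has_real_derivative 0) (at t within {0..})"
    and "0 \<le> t"
  shows "mean_value (h t) = mean_value (h 0)"
  using linear_ode_unique[of "\<lambda>s. mean_value (h s)" 0 t] assms by (simp add: mean_value_def)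

text \<open>Shared core of both models, which differ only in the constant \<open>K\<close>. The mean
  stays zero, so the double integral equals \<open>4 * K\<close> times the energy, and the factor
  \<open>1 / 2\<close> of the weak form leaves the rate \<open>2 * K\<close>.\<close>

lemma energy_growth:
  fixes h :: "real \<Rightarrow> real \<Rightarrow> real"
  assumes h: "\<And>t. 0 \<le> t \<Longrightarrow> prob_density (h t)"
    and h1: "\<And>t. 0 \<le> t \<Longrightarrow> integrable lborel (\<lambda>v. v * h t v)"
    and h2: "\<And>t. 0 \<le> t \<Longrightarrow> integrable lborel (\<lambda>v. v\<^sup>2 * h t v)"
    and mean: "\<And>t. 0 \<le> t \<Longrightarrow> ((\<lambda>s. \<integral>v. v * h s v \<partial>lborel) has_real_derivative 0) (at t within {0..})"
    and deriv: "\<And>t. 0 \<le> t \<Longrightarrow> ((\<lambda>s. \<integral>v. v\<^sup>2 * h s v \<partial>lborel) has_real_derivative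
        1 / 2 * (\<integral>v. (\<integral>w. (2 * K) * (v - w)\<^sup>2 * h t v * h t w \<partial>lborel) \<partial>lborel)) (at t within {0..})"
    and "mean_value (h 0) = 0" and "0 \<le> t"
  shows "energy (h t) = energy (h 0) * exp (2 * K * t)"
proof (rule linear_ode_unique)
  fix s :: real assume s: "0 \<le> s"
  have "mean_value (h s) = 0"
    using mean_conserved[OF mean s] \<open>mean_value (h 0) = 0\<close> by simp
  then have "1 / 2 * (\<integral>v. (\<integral>w. (2 * K) * (v - w)\<^sup>2 * h s v * h s w \<partial>lborel) \<partial>lborel) = 2 * K * energy (h s)"
    using double_integral_square_diff[OF h[OF s] h1[OF s] h2[OF s], of "2 * K"] by simp
  then show "((\<lambda>t. energy (h t)) has_real_derivative 2 * K * energy (h s)) (at s within {0..})"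
    using deriv[OF s] by (simp only: energy_def)
qed fact

text \<open>In this model \<theta> is integrated out inside the collision term, so \<open>K\<close>
  is the average of \<open>(q \<theta>)\<^sup>2 - q \<theta>\<close> and the growth rate no longer
  depends on \<theta>.\<close>

lemma energy_deterministic:
  assumes "deterministic_model \<Phi> q I \<rho> g" "(\<lambda>v. v) \<in> \<Phi>" "(\<lambda>v. v\<^sup>2) \<in> \<Phi>"
    and "mean_value (g 0) = 0" and "0 \<le> t"
  shows "energy (g t) = energy (g 0) * exp (2 * (LINT \<theta>:I|lborel. ((q \<theta>)\<^sup>2 - q \<theta>) * \<rho> \<theta>) * t)"
proof (rule energy_growth)
  note D = assms(1)[unfolded deterministic_model_def]
  fix t :: real assume t: "0 \<le> t"
  show "prob_density (g t)" "integrable lborel (\<lambda>v. v\<^sup>2 * g t v)" "integrable lborel (\<lambda>v. v * g t v)"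
    using D t assms(2) by auto
  show "((\<lambda>s. \<integral>v. v * g s v \<partial>lborel) has_real_derivative 0) (at t within {0..})"
    using D[THEN conjunct2, rule_format, OF assms(2) t]
    by (simp add: collision_gain_id set_lebesgue_integral_def)
  have inner: "(LINT \<theta>:I|lborel. collision_gain (\<lambda>v. v\<^sup>2) (q \<theta>) v w * \<rho> \<theta> * g t v * g t w)
      = 2 * (LINT \<theta>:I|lborel. ((q \<theta>)\<^sup>2 - q \<theta>) * \<rho> \<theta>) * (v - w)\<^sup>2 * g t v * g t w" for v w
  proof -
    have "(LINT \<theta>:I|lborel. collision_gain (\<lambda>v. v\<^sup>2) (q \<theta>) v w * \<rho> \<theta> * g t v * g t w)
      = (LINT \<theta>:I|lborel. (2 * (v - w)\<^sup>2 * g t v * g t w) * (((q \<theta>)\<^sup>2 - q \<theta>) * \<rho> \<theta>))"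
      unfolding set_lebesgue_integral_def collision_gain_square
      by (rule Bochner_Integration.integral_cong) auto
    \<comment> \<open>If the \<theta>-integrand is not integrable, both sides are the default value
      0.\<close>
    also have "\<dots> = (2 * (v - w)\<^sup>2 * g t v * g t w) * (LINT \<theta>:I|lborel. ((q \<theta>)\<^sup>2 - q \<theta>) * \<rho> \<theta>)"
      by (rule set_integral_mult_right)
    finally show ?thesis by (simp only: mult_ac)
  qed
  show "((\<lambda>s. \<integral>v. v\<^sup>2 * g s v \<partial>lborel) has_real_derivative
        1 / 2 * (\<integral>v. (\<integral>w. (2 * (LINT \<theta>:I|lborel. ((q \<theta>)\<^sup>2 - q \<theta>) * \<rho> \<theta>)) * (v - w)\<^sup>2 * g t v * g t w \<partial>lborel) \<partial>lborel)) (at t within {0..})"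
    using D[THEN conjunct2, rule_format, OF assms(3) t] by (simp only: inner)
qed fact+

lemma energy_stochastic:
  assumes "stochastic_model \<Phi> q I f" "(\<lambda>v. v) \<in> \<Phi>" "(\<lambda>v. v\<^sup>2) \<in> \<Phi>" "\<theta> \<in> I"
    and "mean_value (\<lambda>v. f 0 v \<theta>) = 0" and "0 \<le> t"
  shows "energy (\<lambda>v. f t v \<theta>) = energy (\<lambda>v. f 0 v \<theta>) * exp (2 * ((q \<theta>)\<^sup>2 - q \<theta>) * t)"
proof (rule energy_growth[of "\<lambda>t v. f t v \<theta>"])
  note S = assms(1)[unfolded stochastic_model_def]
  fix t :: real assume t: "0 \<le> t"
  show "prob_density (\<lambda>v. f t v \<theta>)" "integrable lborel (\<lambda>v. v\<^sup>2 * f t v \<theta>)" "integrable lborel (\<lambda>v. v * f t v \<theta>)"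
    using S t assms(2,4) by auto
  show "((\<lambda>s. \<integral>v. v * f s v \<theta> \<partial>lborel) has_real_derivative 0) (at t within {0..})"
    using S[THEN conjunct2, THEN conjunct2, rule_format, OF assms(4,2) t]
    by (simp add: collision_gain_id)
  show "((\<lambda>s. \<integral>v. v\<^sup>2 * f s v \<theta> \<partial>lborel) has_real_derivative
        1 / 2 * (\<integral>v. (\<integral>w. (2 * ((q \<theta>)\<^sup>2 - q \<theta>)) * (v - w)\<^sup>2 * f t v \<theta> * f t w \<theta> \<partial>lborel) \<partial>lborel)) (at t within {0..})"
    using S[THEN conjunct2, THEN conjunct2, rule_format, OF assms(4,3) t]
    by (simp add: collision_gain_square)
qed fact+

section \<open>Laws and the Wasserstein distance to a Dirac mass\<close>

text \<open>The mean depends on the law alone. This matters because the initial data of the two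
  models agree as laws, while their densities may differ on a null set.\<close>

lemma mean_value_cong_law:
  assumes "prob_density p" "prob_density p'" "law p = law p'"
  shows "mean_value p = mean_value p'"
proof -
  have "mean_value p = (\<integral>v. v \<partial>law p)" if "prob_density p" for p
    unfolding law_def mean_value_def using prob_densityD(1,2)[OF that]
    by (subst integral_density) (auto simp: mult.commute)
  then show ?thesis using assms by metis
qed

text \<open>The push-forward of the law under \<open>v \<mapsto> (v, 0)\<close> is a coupling whose
  cost is exactly the energy. The infimum lies below it, and an upper bound is all that convergence
  to 0 requires.\<close>

lemma W2_le_sqrt_energy:
  assumes p: "prob_density p" and p2: "integrable lborel (\<lambda>v. v\<^sup>2 * p v)"
  shows "W2 (law p) (return borel 0) \<le> ennreal (sqrt (energy p))"
proof -
  note [measurable] = prob_densityD(1)[OF p] and nn = prob_densityD(2)[OF p]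
  interpret prob_space "law p"
    using p by (simp add: prob_density_def law_def)
  have sets: "sets (law p) = sets borel" and space: "space (law p) = UNIV"
    by (simp_all add: law_def)
  define \<pi> where "\<pi> = distr (law p) (borel \<Otimes>\<^sub>M borel) (\<lambda>v. (v, 0::real))"
  have meas: "(\<lambda>v. (v, 0::real)) \<in> law p \<rightarrow>\<^sub>M borel \<Otimes>\<^sub>M borel"
    by (simp add: measurable_cong_sets[OF sets refl])
  have id: "distr (law p) borel (\<lambda>v. v) = law p"
    by (rule distr_id2) (simp add: sets)
  have const: "distr (law p) borel (\<lambda>v. 0::real) = return borel 0"
    by (rule measure_eqI) (auto simp: emeasure_distr measurable_cong_sets[OF sets refl] space emeasure_space_1[simplified space] indicator_def vimage_def)
  have "\<pi> \<in> couplings (law p) (return borel 0)"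
    unfolding couplings_def \<pi>_def
    using meas by (auto simp: prob_space_distr distr_distr comp_def id const)
  then have "(INF \<pi>\<in>couplings (law p) (return borel 0). \<integral>\<^sup>+ z. ennreal (\<bar>fst z - snd z\<bar>\<^sup>2) \<partial>\<pi>)
      \<le> (\<integral>\<^sup>+ z. ennreal (\<bar>fst z - snd z\<bar>\<^sup>2) \<partial>\<pi>)"
    by (rule INF_lower)
  also have "\<dots> = (\<integral>\<^sup>+ v. ennreal (v\<^sup>2) \<partial>law p)"
    unfolding \<pi>_def by (subst nn_integral_distr[OF meas]) auto
  also have "\<dots> = (\<integral>\<^sup>+ v. ennreal (v\<^sup>2 * p v) \<partial>lborel)"
    unfolding law_def using nn by (subst nn_integral_density) (auto simp: ennreal_mult mult.commute)
  also have "\<dots> = ennreal (energy p)"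
    unfolding energy_def using p2 nn by (subst nn_integral_eq_integral) auto
  finally have le: "(INF \<pi>\<in>couplings (law p) (return borel 0). \<integral>\<^sup>+ z. ennreal (\<bar>fst z - snd z\<bar>\<^sup>2) \<partial>\<pi>)
      \<le> ennreal (energy p)" .
  have "0 \<le> energy p"
    unfolding energy_def using nn by (intro integral_nonneg_AE) auto
  \<comment> \<open>A finite bound excludes the infinite branch of \<open>ennreal_sqrt\<close>; on
    finite values it is the monotone real square root.\<close>
  have mono: "ennreal_sqrt x \<le> ennreal (sqrt b)" if "x \<le> ennreal b" "0 \<le> b" for x b
    using that by (cases x) (auto simp: ennreal_sqrt_def ennreal_le_iff top_unique)
  show ?thesis
    unfolding W2_def by (rule mono[OF le \<open>0 \<le> energy p\<close>])
qed

lemma W2_tendsto_0: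
  assumes p: "\<And>t. 0 \<le> t \<Longrightarrow> prob_density (p t)"
    and p2: "\<And>t. 0 \<le> t \<Longrightarrow> integrable lborel (\<lambda>v. v\<^sup>2 * p t v)"
    and lim: "((\<lambda>t::real. energy (p t)) \<longlongrightarrow> 0) at_top"
  shows "((\<lambda>t. W2 (law (p t)) (return borel 0)) \<longlongrightarrow> 0) at_top"
proof (rule tendsto_sandwich[OF _ _ tendsto_const])
  show "\<forall>\<^sub>F t in at_top. W2 (law (p t)) (return borel 0) \<le> ennreal (sqrt (energy (p t)))"
    using eventually_ge_at_top[of 0] by eventually_elim (auto intro: W2_le_sqrt_energy p p2)
  show "((\<lambda>t. ennreal (sqrt (energy (p t)))) \<longlongrightarrow> 0) at_top"
    using tendsto_ennrealI[OF tendsto_real_sqrt[OF lim]] by simp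
qed auto

section \<open>Averaging over the random parameter\<close>

text \<open>Exchange of the \<theta>-average with the \<open>v\<close>-integral; all factors are
  nonnegative, so integrability of the iterated integral suffices. The weight \<open>u\<close> is
  kept general to serve both the total mass (\<open>u = 1\<close>) and the energy
  (\<open>u = v\<^sup>2\<close>).\<close>

lemma averaged_weighted_integral:
  fixes u \<rho> :: "real \<Rightarrow> real"
  assumes [measurable]: "I \<in> sets borel" "\<rho> \<in> borel_measurable borel" "u \<in> borel_measurable borel"
    and \<rho>: "\<And>\<theta>. 0 \<le> \<rho> \<theta>" and u: "\<And>v. 0 \<le> u v"
    and fm: "set_borel_measurable borel (UNIV \<times> I) (\<lambda>(v, \<theta>). f t v \<theta>)"
    and f: "\<And>v \<theta>. \<theta> \<in> I \<Longrightarrow> 0 \<le> f t v \<theta>"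
    and fi: "\<And>\<theta>. \<theta> \<in> I \<Longrightarrow> integrable lborel (\<lambda>v. u v * f t v \<theta>)"
    and int: "set_integrable lborel I (\<lambda>\<theta>. \<rho> \<theta> * (\<integral>v. u v * f t v \<theta> \<partial>lborel))"
  shows "averaged I \<rho> f t \<in> borel_measurable borel"
    and "integrable lborel (\<lambda>v. u v * averaged I \<rho> f t v)"
    and "(\<integral>v. u v * averaged I \<rho> f t v \<partial>lborel) = (LINT \<theta>:I|lborel. \<rho> \<theta> * (\<integral>v. u v * f t v \<theta> \<partial>lborel))"
proof -
  \<comment> \<open>Measurability of \<open>f t\<close> is known only on
    \<open>UNIV \<times> I\<close>. Extension by zero gives a Borel function on the whole plane
    without changing any integral over \<open>I\<close>.\<close>
  define F where "F = (\<lambda>v \<theta>. indicator I \<theta> * f t v \<theta>)"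
  have [measurable]: "case_prod F \<in> borel_measurable (borel \<Otimes>\<^sub>M borel)"
  proof -
    have "(\<lambda>x. indicator (UNIV \<times> I) x *\<^sub>R (case x of (v, \<theta>) \<Rightarrow> f t v \<theta>)) = case_prod F"
      by (auto simp: F_def indicator_def fun_eq_iff)
    then show ?thesis
      using fm unfolding set_borel_measurable_def by (simp add: borel_prod)
  qed
  have F0: "0 \<le> F v \<theta>" for v \<theta> using f by (auto simp: F_def indicator_def)
  have avg: "averaged I \<rho> f t = (\<lambda>v. \<integral>\<theta>. F v \<theta> * \<rho> \<theta> \<partial>lborel)"
    by (auto simp: averaged_def set_lebesgue_integral_def F_def fun_eq_iff intro!: Bochner_Integration.integral_cong)
  show "averaged I \<rho> f t \<in> borel_measurable borel"
    unfolding avg by measurable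
  have uF: "integrable lborel (\<lambda>v. u v * (F v \<theta> * \<rho> \<theta>))" for \<theta>
  proof (cases "\<theta> \<in> I")
    case True
    then show ?thesis
      using integrable_mult_right[OF fi[OF True], of "\<rho> \<theta>"] by (simp add: F_def mult_ac)
  qed (simp add: F_def)
  have inner: "(\<integral>v. u v * (F v \<theta> * \<rho> \<theta>) \<partial>lborel) = indicator I \<theta> * (\<rho> \<theta> * (\<integral>v. u v * f t v \<theta> \<partial>lborel))" for \<theta>
  proof -
    have "(\<integral>v. u v * (F v \<theta> * \<rho> \<theta>) \<partial>lborel) = (\<integral>v. (indicator I \<theta> * \<rho> \<theta>) * (u v * f t v \<theta>) \<partial>lborel)"
      by (rule Bochner_Integration.integral_cong) (auto simp: F_def)
    then show ?thesis by simp
  qed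
  have J: "integrable (lborel \<Otimes>\<^sub>M lborel) (\<lambda>(\<theta>, v). u v * (F v \<theta> * \<rho> \<theta>))"
  proof (rule lborel_pair.Fubini_integrable)
    show "(\<lambda>(\<theta>, v). u v * (F v \<theta> * \<rho> \<theta>)) \<in> borel_measurable (lborel \<Otimes>\<^sub>M lborel)"
      by measurable
    \<comment> \<open>By nonnegativity the norm is the integrand itself, which turns the assumption
      \<open>int\<close> into the absolute integrability that Fubini asks for.\<close>
    have "(\<lambda>\<theta>. \<integral>v. norm (u v * (F v \<theta> * \<rho> \<theta>)) \<partial>lborel) = (\<lambda>\<theta>. indicator I \<theta> * (\<rho> \<theta> * (\<integral>v. u v * f t v \<theta> \<partial>lborel)))"
      using u F0 \<rho> by (simp add: inner[symmetric])
    then show "integrable lborel (\<lambda>\<theta>. \<integral>v. norm (case (\<theta>, v) of (\<theta>, v) \<Rightarrow> u v * (F v \<theta> * \<rho> \<theta>)) \<partial>lborel)"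
      using int by (simp add: set_integrable_def)
  qed (use uF in auto)
  have "integrable lborel (\<lambda>v. \<integral>\<theta>. u v * (F v \<theta> * \<rho> \<theta>) \<partial>lborel)"
    using lborel_pair.integrable_snd[OF J] .
  then show "integrable lborel (\<lambda>v. u v * averaged I \<rho> f t v)"
    by (simp add: avg)
  have "(\<integral>v. (\<integral>\<theta>. u v * (F v \<theta> * \<rho> \<theta>) \<partial>lborel) \<partial>lborel) = (\<integral>\<theta>. (\<integral>v. u v * (F v \<theta> * \<rho> \<theta>) \<partial>lborel) \<partial>lborel)"
    using lborel_pair.Fubini_integral[OF J] .
  then show "(\<integral>v. u v * averaged I \<rho> f t v \<partial>lborel) = (LINT \<theta>:I|lborel. \<rho> \<theta> * (\<integral>v. u v * f t v \<theta> \<partial>lborel))"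
    by (simp add: avg inner set_lebesgue_integral_def)
qed

section \<open>Laplace asymptotics at the endpoints of an interval\<close>

text \<open>The exponent increases on \<open>{0..1}\<close> to its maximum 0 at
  \<open>s = 1\<close>, where its slope is \<open>2 * A + B\<close>. For large \<open>t\<close> the
  integral behaves like that of \<open>exp (t * (2 * A + B) * (s - 1))\<close>, which is about
  \<open>1 / ((2 * A + B) * t)\<close>.\<close>

lemma laplace_endpoint:
  fixes A B :: real
  assumes "0 < A" "0 \<le> B"
  shows "((\<lambda>t. t * integral {0..1} (\<lambda>s. exp (t * (A * (s\<^sup>2 - 1) + B * (s - 1))))) \<longlongrightarrow> 1 / (2 * A + B)) at_top"
proof -
  define \<psi> where "\<psi> = (\<lambda>s. A * (s\<^sup>2 - 1) + B * (s - 1))"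
  define J where "J = (\<lambda>t. integral {0..1} (\<lambda>s. exp (t * \<psi> s)))"
  define R where "R = (\<lambda>t. integral {0..1} (\<lambda>s. (1 - s) * exp (t * \<psi> s)))"
  have cont\<psi>: "continuous_on {0..1} \<psi>"
    unfolding \<psi>_def by (intro continuous_intros)
  have cont: "continuous_on {0..1} (\<lambda>s. exp (t * \<psi> s))" for t
    unfolding \<psi>_def by (intro continuous_intros)
  \<comment> \<open>Split \<open>2A + B\<close> as \<open>\<psi>' s + 2A (1 - s)\<close>: the first part integrates exactly, the second vanishes at
    the endpoint where the exponential concentrates.\<close>
  have parts: "(2 * A + B) * (t * J t) = 1 - exp (- (A + B) * t) + 2 * A * (t * R t)" for t
  proof -
    have "((\<lambda>s. t * (2 * A * s + B) * exp (t * \<psi> s)) has_integral (exp (t * \<psi> 1) - exp (t * \<psi> 0))) {0..1}"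
      by (rule fundamental_theorem_of_calculus)
        (auto intro!: derivative_eq_intros simp: \<psi>_def algebra_simps simp flip: has_real_derivative_iff_has_vector_derivative)
    then have I: "integral {0..1} (\<lambda>s. t * (2 * A * s + B) * exp (t * \<psi> s)) = 1 - exp (- (A + B) * t)"
      by (simp add: \<psi>_def integral_unique algebra_simps)
    have "(2 * A + B) * (t * J t) = integral {0..1} (\<lambda>s. ((2 * A + B) * t) * exp (t * \<psi> s))"
      unfolding J_def by simp
    also have "\<dots> = integral {0..1} (\<lambda>s. t * (2 * A * s + B) * exp (t * \<psi> s) + (2 * A * t) * ((1 - s) * exp (t * \<psi> s)))"
      by (simp add: algebra_simps)
    also have "\<dots> = integral {0..1} (\<lambda>s. t * (2 * A * s + B) * exp (t * \<psi> s)) + integral {0..1} (\<lambda>s. (2 * A * t) * ((1 - s) * exp (t * \<psi> s)))"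
      by (intro Henstock_Kurzweil_Integration.integral_add integrable_continuous_interval continuous_intros cont)
    also have "integral {0..1} (\<lambda>s. (2 * A * t) * ((1 - s) * exp (t * \<psi> s))) = 2 * A * t * R t"
      unfolding R_def by (rule integral_mult_right)
    finally show ?thesis by (simp add: I)
  qed
  have R0: "0 \<le> t * R t" if "0 < t" for t
    unfolding R_def using that by (intro mult_nonneg_nonneg Henstock_Kurzweil_Integration.integral_nonneg integrable_continuous_interval continuous_intros cont) auto
  \<comment> \<open>On \<open>{0..1}\<close> the convex exponent lies below its chord
    \<open>(A + B) * (s - 1)\<close>, and the integral with the chord is explicit. The extra factor
    \<open>1 - s\<close> gains one power of \<open>t\<close>.\<close>
  have R1: "t * R t \<le> 1 / ((A + B)\<^sup>2 * t)" if t: "0 < t" for t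
  proof -
    define x where "x = (A + B) * t"
    have x: "0 < x" using assms t by (simp add: x_def)
    \<comment> \<open>The antiderivative is
      \<open>((1 - s) / x + 1 / x\<^sup>2) * exp (x * (s - 1))\<close>. Its value at
      \<open>0\<close> is positive, so dropping that term leaves the upper bound
      \<open>1 / x\<^sup>2\<close>.\<close>
    have I: "((\<lambda>s. (1 - s) * exp (x * (s - 1))) has_integral
        (((1 - 1) / x + 1 / x\<^sup>2) * exp (x * (1 - 1)) - ((1 - 0) / x + 1 / x\<^sup>2) * exp (x * (0 - 1)))) {0..1}"
      by (rule fundamental_theorem_of_calculus)
        (use x in \<open>auto intro!: derivative_eq_intros simp: field_simps power2_eq_square simp flip: has_real_derivative_iff_has_vector_derivative\<close>)
    have "R t \<le> integral {0..1} (\<lambda>s. (1 - s) * exp (x * (s - 1)))"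
      unfolding R_def
    proof (intro integral_le integrable_continuous_interval continuous_intros cont\<psi>)
      fix s :: real assume s: "s \<in> {0..1}"
      have "s\<^sup>2 \<le> s" using s by (simp add: power2_eq_square mult_left_le)
      then have "A * (s\<^sup>2 - 1) \<le> A * (s - 1)" using assms by simp
      then have "\<psi> s \<le> (A + B) * (s - 1)" by (simp add: \<psi>_def algebra_simps)
      then have "t * \<psi> s \<le> x * (s - 1)" using t by (simp add: x_def mult.commute mult.left_commute)
      then show "(1 - s) * exp (t * \<psi> s) \<le> (1 - s) * exp (x * (s - 1))"
        using s by (intro mult_left_mono) auto
    qed
    also have "\<dots> \<le> 1 / x\<^sup>2"
      using integral_unique[OF I] x by simp
    finally have "t * R t \<le> t * (1 / x\<^sup>2)" using t by (intro mult_left_mono) auto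
    also have "\<dots> = 1 / ((A + B)\<^sup>2 * t)"
      using t by (simp add: x_def power2_eq_square)
    finally show ?thesis .
  qed
  have AB: "0 < A + B" "0 < 2 * A + B" using assms by auto
  have Rlim: "((\<lambda>t. t * R t) \<longlongrightarrow> 0) at_top"
  proof (rule tendsto_sandwich)
    show "\<forall>\<^sub>F t in at_top. 0 \<le> t * R t" 
      using eventually_gt_at_top[of 0] by eventually_elim (rule R0)
    show "\<forall>\<^sub>F t in at_top. t * R t \<le> 1 / ((A + B)\<^sup>2 * t)"
      using eventually_gt_at_top[of 0] by eventually_elim (rule R1)
    show "((\<lambda>t. 1 / ((A + B)\<^sup>2 * t)) \<longlongrightarrow> 0) at_top"
      using AB by real_asymp
  qed simp
  have "((\<lambda>t. 1 - exp (- (A + B) * t)) \<longlongrightarrow> 1) at_top"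
    using AB by real_asymp
  from tendsto_add[OF this tendsto_mult[OF tendsto_const Rlim]]
  have "((\<lambda>t. (2 * A + B) * (t * J t)) \<longlongrightarrow> 1) at_top"
    unfolding parts by simp
  from tendsto_divide[OF this tendsto_const[of "2 * A + B"]]
  show ?thesis using AB by (simp add: J_def \<psi>_def)
qed

text \<open>The maximum \<open>A + \<bar>B\<bar>\<close> of the exponent sits at one endpoint, or at
  both when \<open>B = 0\<close>. The limit then doubles, so only its existence and positivity are
  exported.\<close>

lemma laplace_two_endpoints:
  fixes A B :: real
  assumes "0 < A"
  obtains c where "0 < c"
    "((\<lambda>t. t * exp (- (A + \<bar>B\<bar>) * t) * integral {-1..1} (\<lambda>s. exp (t * (A * s\<^sup>2 + B * s)))) \<longlongrightarrow> c) at_top"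
proof -
  define b where "b = \<bar>B\<bar>"
  define J1 where "J1 = (\<lambda>t. integral {0..1} (\<lambda>s. exp (t * (A * (s\<^sup>2 - 1) + b * (s - 1)))))"
  define J2 where "J2 = (\<lambda>t. integral {0..1} (\<lambda>s. exp (t * (A * (s\<^sup>2 - 1) - b * (s + 1)))))"
  \<comment> \<open>After division by the exponential of the maximum, \<open>J1\<close> is the half
    containing a maximising endpoint and \<open>J2\<close> the other half reflected to
    \<open>{0..1}\<close>.\<close>
  have split: "exp (- (A + b) * t) * integral {-1..1} (\<lambda>s. exp (t * (A * s\<^sup>2 + B * s))) = J1 t + J2 t" for t
  proof -
    have "integral {-1..1} (\<lambda>s. exp (t * (A * s\<^sup>2 + B * s)))
        = integral {-1..0} (\<lambda>s. exp (t * (A * s\<^sup>2 + B * s))) + integral {0..1} (\<lambda>s. exp (t * (A * s\<^sup>2 + B * s)))"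
      by (rule Henstock_Kurzweil_Integration.integral_combine[symmetric])
        (auto intro!: integrable_continuous_interval continuous_intros)
    also have "integral {-1..0} (\<lambda>s. exp (t * (A * s\<^sup>2 + B * s))) = integral {0..1} (\<lambda>s. exp (t * (A * s\<^sup>2 - B * s)))"
      using Henstock_Kurzweil_Integration.integral_reflect_real[of 1 0 "\<lambda>s. exp (t * (A * s\<^sup>2 - B * s))"] by simp
    \<comment> \<open>Passing from \<open>B\<close> to its absolute value at most swaps the two
      halves.\<close>
    finally have "integral {-1..1} (\<lambda>s. exp (t * (A * s\<^sup>2 + B * s)))
      = integral {0..1} (\<lambda>s. exp (t * (A * s\<^sup>2 + b * s))) + integral {0..1} (\<lambda>s. exp (t * (A * s\<^sup>2 - b * s)))"
      unfolding b_def by (cases "0 \<le> B") auto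
    moreover have "J1 t = exp (- (A + b) * t) * integral {0..1} (\<lambda>s. exp (t * (A * s\<^sup>2 + b * s)))"
      unfolding J1_def integral_mult_right[symmetric]
      by (rule Henstock_Kurzweil_Integration.integral_cong) (auto simp: algebra_simps simp flip: exp_add)
    moreover have "J2 t = exp (- (A + b) * t) * integral {0..1} (\<lambda>s. exp (t * (A * s\<^sup>2 - b * s)))"
      unfolding J2_def integral_mult_right[symmetric]
      by (rule Henstock_Kurzweil_Integration.integral_cong) (auto simp: algebra_simps simp flip: exp_add)
    ultimately show ?thesis by (simp add: algebra_simps)
  qed
  have lim1: "((\<lambda>t. t * J1 t) \<longlongrightarrow> 1 / (2 * A + b)) at_top"
    unfolding J1_def by (rule laplace_endpoint) (auto simp: b_def assms)
  \<comment> \<open>If \<open>b = 0\<close> both endpoints contribute equally. Otherwise the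
    exponent of \<open>J2\<close> is at most \<open>- b\<close>, the contribution is exponentially
    small, and \<open>d = 0\<close>.\<close>
  obtain d where d: "0 \<le> d" "((\<lambda>t. t * J2 t) \<longlongrightarrow> d) at_top"
  proof (cases "b = 0")
    case True
    then have "J2 = J1" by (simp add: J1_def J2_def)
    then show ?thesis using that[of "1 / (2 * A + b)"] lim1 True assms by simp
  next
    case False
    then have b: "0 < b" by (simp add: b_def)
    have J2: "0 \<le> J2 t \<and> J2 t \<le> exp (- b * t)" if t: "0 < t" for t
    proof
      show "0 \<le> J2 t" unfolding J2_def
        by (intro Henstock_Kurzweil_Integration.integral_nonneg integrable_continuous_interval continuous_intros) auto
      have "J2 t \<le> integral {0..1} (\<lambda>s::real. exp (- b * t))" unfolding J2_def
      proof (intro integral_le integrable_continuous_interval continuous_intros)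
        fix s :: real assume s: "s \<in> {0..1}"
        have "A * (s\<^sup>2 - 1) \<le> 0" using s assms by (simp add: mult_le_0_iff power_le_one)
        moreover have "b * (s + 1) \<ge> b" using s b by (simp add: algebra_simps)
        ultimately have "A * (s\<^sup>2 - 1) - b * (s + 1) \<le> - b" by simp
        from mult_left_mono[OF this, of t] t
        show "exp (t * (A * (s\<^sup>2 - 1) - b * (s + 1))) \<le> exp (- b * t)" by (simp add: mult.commute)
      qed
      then show "J2 t \<le> exp (- b * t)" by simp
    qed
    have "((\<lambda>t. t * J2 t) \<longlongrightarrow> 0) at_top"
    proof (rule tendsto_sandwich)
      show "\<forall>\<^sub>F t in at_top. 0 \<le> t * J2 t"
        using eventually_gt_at_top[of 0] by eventually_elim (use J2 in simp)
      show "\<forall>\<^sub>F t in at_top. t * J2 t \<le> t * exp (- b * t)"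
        using eventually_gt_at_top[of 0] by eventually_elim (use J2 in simp)
      show "((\<lambda>t. t * exp (- b * t)) \<longlongrightarrow> 0) at_top"
        using b by real_asymp
    qed simp
    then show ?thesis using that by auto
  qed
  show ?thesis
  proof (rule that)
    show "0 < 1 / (2 * A + b) + d" using assms d(1) by (intro add_pos_nonneg) (auto simp: b_def intro: add_pos_nonneg)
    show "((\<lambda>t. t * exp (- (A + \<bar>B\<bar>) * t) * integral {-1..1} (\<lambda>s. exp (t * (A * s\<^sup>2 + B * s)))) \<longlongrightarrow> 1 / (2 * A + b) + d) at_top"
      using tendsto_add[OF lim1 d(2)] split by (simp add: b_def mult.assoc distrib_left)
  qed
qed

section \<open>Expectations under the law of the parameter\<close>

text \<open>Translates the integrals over \<open>I\<close> against \<open>\<rho>\<close>, which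
  occur in the models, into expectations on \<open>M\<close>. Since \<open>\<Theta>\<close> takes
  values in \<open>I\<close>, the indicator of \<open>I\<close> is 1 along
  \<open>\<Theta>\<close>.\<close>

lemma set_integral_distributed:
  fixes h \<rho> :: "real \<Rightarrow> real"
  assumes D: "distributed M lborel \<Theta> (\<lambda>\<theta>. ennreal (\<rho> \<theta>))" and \<rho>: "\<And>\<theta>. 0 \<le> \<rho> \<theta>"
    and I: "\<And>\<omega>. \<omega> \<in> space M \<Longrightarrow> \<Theta> \<omega> \<in> I" and [measurable]: "I \<in> sets borel" "h \<in> borel_measurable borel"
  shows "(LINT \<theta>:I|lborel. \<rho> \<theta> * h \<theta>) = (\<integral>\<omega>. h (\<Theta> \<omega>) \<partial>M)"
    and "set_integrable lborel I (\<lambda>\<theta>. \<rho> \<theta> * h \<theta>) \<longleftrightarrow> integrable M (\<lambda>\<omega>. h (\<Theta> \<omega>))"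
proof -
  have *: "(\<lambda>\<theta>. indicator I \<theta> *\<^sub>R (\<rho> \<theta> * h \<theta>)) = (\<lambda>\<theta>. \<rho> \<theta> * (indicator I \<theta> * h \<theta>))"
    by auto
  show "(LINT \<theta>:I|lborel. \<rho> \<theta> * h \<theta>) = (\<integral>\<omega>. h (\<Theta> \<omega>) \<partial>M)"
    unfolding set_lebesgue_integral_def *
    by (subst distributed_integral[OF D]) (auto simp: \<rho> I intro!: Bochner_Integration.integral_cong)
  have "integrable lborel (\<lambda>\<theta>. \<rho> \<theta> * (indicator I \<theta> * h \<theta>)) \<longleftrightarrow> integrable M (\<lambda>\<omega>. indicator I (\<Theta> \<omega>) * h (\<Theta> \<omega>))"
    by (rule distributed_integrable[OF D]) (auto simp: \<rho>)
  also have "\<dots> \<longleftrightarrow> integrable M (\<lambda>\<omega>. h (\<Theta> \<omega>))"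
    by (rule Bochner_Integration.integrable_cong) (auto simp: I)
  finally show "set_integrable lborel I (\<lambda>\<theta>. \<rho> \<theta> * h \<theta>) \<longleftrightarrow> integrable M (\<lambda>\<omega>. h (\<Theta> \<omega>))"
    unfolding set_integrable_def * .
qed

text \<open>The function \<open>e\<close> is a Borel function on the whole line that represents the
  energy on \<open>I\<close>, the only place where the model determines it. The rest is the averaged
  integral with weights \<open>1\<close> and \<open>v\<^sup>2\<close>.\<close>

lemma averaged_stochastic_model:
  fixes e \<rho> :: "real \<Rightarrow> real"
  assumes M: "prob_space M" and D: "distributed M lborel \<Theta> (\<lambda>\<theta>. ennreal (\<rho> \<theta>))" and \<rho>: "\<And>\<theta>. 0 \<le> \<rho> \<theta>"
    and I: "\<And>\<omega>. \<omega> \<in> space M \<Longrightarrow> \<Theta> \<omega> \<in> I" and Im: "I \<in> sets borel"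
    and S: "stochastic_model \<Phi> q I f" and t: "0 \<le> t"
    and em: "e \<in> borel_measurable borel" and e: "\<And>\<theta>. \<theta> \<in> I \<Longrightarrow> energy (\<lambda>v. f t v \<theta>) = e \<theta>"
    and ei: "integrable M (\<lambda>\<omega>. e (\<Theta> \<omega>))"
  shows "prob_density (averaged I \<rho> f t)"
    and "integrable lborel (\<lambda>v. v\<^sup>2 * averaged I \<rho> f t v)"
    and "energy (averaged I \<rho> f t) = (\<integral>\<omega>. e (\<Theta> \<omega>) \<partial>M)"
proof -
  interpret prob_space M by fact
  have \<rho>m: "\<rho> \<in> borel_measurable borel"
    using distributed_real_measurable[OF _ D] \<rho> by simp
  have fm: "set_borel_measurable borel (UNIV \<times> I) (\<lambda>(v, \<theta>). f t v \<theta>)"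
    and f: "\<And>\<theta>. \<theta> \<in> I \<Longrightarrow> prob_density (\<lambda>v. f t v \<theta>)"
    and f2: "\<And>\<theta>. \<theta> \<in> I \<Longrightarrow> integrable lborel (\<lambda>v. v\<^sup>2 * f t v \<theta>)"
    using S t by (auto simp: stochastic_model_def)
  have E: "(LINT \<theta>:I|lborel. \<rho> \<theta> * (\<integral>v. u v * f t v \<theta> \<partial>lborel)) = (\<integral>\<omega>. h (\<Theta> \<omega>) \<partial>M)"
    "set_integrable lborel I (\<lambda>\<theta>. \<rho> \<theta> * (\<integral>v. u v * f t v \<theta> \<partial>lborel)) \<longleftrightarrow> integrable M (\<lambda>\<omega>. h (\<Theta> \<omega>))"
    if "h \<in> borel_measurable borel" "\<And>\<theta>. \<theta> \<in> I \<Longrightarrow> (\<integral>v. u v * f t v \<theta> \<partial>lborel) = h \<theta>" for u h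
  proof -
    have *: "(\<lambda>\<theta>. indicator I \<theta> *\<^sub>R (\<rho> \<theta> * (\<integral>v. u v * f t v \<theta> \<partial>lborel))) = (\<lambda>\<theta>. indicator I \<theta> *\<^sub>R (\<rho> \<theta> * h \<theta>))"
      using that(2) by (auto simp: indicator_def fun_eq_iff)
    show "(LINT \<theta>:I|lborel. \<rho> \<theta> * (\<integral>v. u v * f t v \<theta> \<partial>lborel)) = (\<integral>\<omega>. h (\<Theta> \<omega>) \<partial>M)"
      unfolding set_lebesgue_integral_def *
      using set_integral_distributed(1)[OF D \<rho> I Im that(1)] by (simp add: set_lebesgue_integral_def)
    show "set_integrable lborel I (\<lambda>\<theta>. \<rho> \<theta> * (\<integral>v. u v * f t v \<theta> \<partial>lborel)) \<longleftrightarrow> integrable M (\<lambda>\<omega>. h (\<Theta> \<omega>))"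
      unfolding set_integrable_def *
      using set_integral_distributed(2)[OF D \<rho> I Im that(1)] by (simp add: set_integrable_def)
  qed
  have i1: "\<And>\<theta>. \<theta> \<in> I \<Longrightarrow> (\<integral>v. 1 * f t v \<theta> \<partial>lborel) = 1"
    using prob_densityD(4)[OF f] by simp
  have i2: "\<And>\<theta>. \<theta> \<in> I \<Longrightarrow> (\<integral>v. v\<^sup>2 * f t v \<theta> \<partial>lborel) = e \<theta>"
    using e by (simp add: energy_def)
  have f1: "\<And>\<theta>. \<theta> \<in> I \<Longrightarrow> integrable lborel (\<lambda>v. 1 * f t v \<theta>)"
    using prob_densityD(3)[OF f] by simp
  have E1: "set_integrable lborel I (\<lambda>\<theta>. \<rho> \<theta> * (\<integral>v. 1 * f t v \<theta> \<partial>lborel))"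
    using E(2)[of "\<lambda>_. 1" "\<lambda>_. 1", OF _ i1] by simp
  have E2: "set_integrable lborel I (\<lambda>\<theta>. \<rho> \<theta> * (\<integral>v. v\<^sup>2 * f t v \<theta> \<partial>lborel))"
    using E(2)[of e "\<lambda>v. v\<^sup>2", OF em i2] ei by simp
  note A1 = averaged_weighted_integral[where u="\<lambda>_. 1" and f=f and t=t, OF Im \<rho>m _ \<rho> _ fm prob_densityD(2)[OF f] f1 E1, simplified]
  note A2 = averaged_weighted_integral[where u="\<lambda>v. v\<^sup>2" and f=f and t=t, OF Im \<rho>m _ \<rho> _ fm prob_densityD(2)[OF f] f2 E2, simplified]
  show "prob_density (averaged I \<rho> f t)"
  proof (rule prob_densityI)
    show "0 \<le> averaged I \<rho> f t x" for x
      unfolding averaged_def set_lebesgue_integral_def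
      using \<rho> prob_densityD(2)[OF f] by (intro integral_nonneg_AE) (auto simp: indicator_def)
    show "(\<integral>v. averaged I \<rho> f t v \<partial>lborel) = 1"
      using A1(3) E(1)[of "\<lambda>_. 1" "\<lambda>_. 1", OF _ i1] by (simp add: prob_space)
  qed (use A1(1,2) in auto)
  show "integrable lborel (\<lambda>v. v\<^sup>2 * averaged I \<rho> f t v)"
    using A2(2) by simp
  show "energy (averaged I \<rho> f t) = (\<integral>\<omega>. e (\<Theta> \<omega>) \<partial>M)"
    using A2(3) E(1)[of e "\<lambda>v. v\<^sup>2", OF em i2] by (simp add: energy_def)
qed

text \<open>Passes from the law as a uniform measure to the density form in which mean and variance
  of the uniform law are available.\<close>

lemma uniform_distributedI:
  fixes a b :: real
  assumes "a < b" "X \<in> borel_measurable M" "distr M lborel X = uniform_measure lborel {a..b}"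
  shows "distributed M lborel X (\<lambda>x. indicator {a..b} x / measure lborel {a..b})"
proof -
  have "ennreal (indicator {a..b} x / measure lborel {a..b}) = indicator {a..b} x / emeasure lborel {a..b}" for x
    using \<open>a < b\<close> by (auto simp: indicator_def divide_ennreal ennreal_1[symmetric] simp del: ennreal_1)
  then show ?thesis
    using assms by (simp add: distributed_def uniform_measure_def)
qed

text \<open>Links expectations to the gauge integral used in the Laplace estimates; on a compact
  interval a continuous function has the same Lebesgue and gauge integral.\<close>

lemma uniform_expectation_continuous:
  fixes a b :: real and h :: "real \<Rightarrow> real"
  assumes D: "distributed M lborel X (\<lambda>x. indicator {a..b} x / measure lborel {a..b})" and "a < b"
    and h: "continuous_on UNIV h"
  shows "integrable M (\<lambda>\<omega>. h (X \<omega>))" and "(\<integral>\<omega>. h (X \<omega>) \<partial>M) = integral {a..b} h / (b - a)"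
proof -
  have m: "h \<in> borel_measurable lborel"
    using borel_measurable_continuous_onI[OF h] by simp
  have si: "set_integrable lborel {a..b} h"
    by (intro borel_integrable_atLeastAtMost' continuous_on_subset[OF h]) auto
  have *: "(\<lambda>x. indicator {a..b} x / measure lborel {a..b} * h x) = (\<lambda>x. (indicator {a..b} x *\<^sub>R h x) / (b - a))"
    using \<open>a < b\<close> by auto
  show "integrable M (\<lambda>\<omega>. h (X \<omega>))"
    using distributed_integrable[OF D m] si * \<open>a < b\<close> by (auto simp: set_integrable_def simp del: content_real_if)
  show "(\<integral>\<omega>. h (X \<omega>) \<partial>M) = integral {a..b} h / (b - a)"
    using distributed_integral[OF D m] set_borel_integral_eq_integral(2)[OF si] * \<open>a < b\<close>
    by (auto simp: set_lebesgue_integral_def simp del: content_real_if)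
qed



theorem mainTheorem2:
  fixes M :: "'a measure" and \<Theta> :: "'a \<Rightarrow> real" and I :: "real set" and \<rho> q :: "real \<Rightarrow> real"
    and \<Phi> :: "(real \<Rightarrow> real) set"
    and g :: "real \<Rightarrow> real \<Rightarrow> real" and f :: "real \<Rightarrow> real \<Rightarrow> real \<Rightarrow> real"
    and q0 lam :: real
  assumes "prob_space M"
    and "\<And>\<omega>. \<omega> \<in> space M \<Longrightarrow> \<Theta> \<omega> \<in> I"
    and "I \<in> sets borel"
    and "\<And>\<theta>. 0 \<le> \<rho> \<theta>"
    and "distributed M lborel \<Theta> (\<lambda>\<theta>. ennreal (\<rho> \<theta>))"
    and "0 < q0" and "q0 < 1" and "0 < lam"
    and "\<And>\<theta>. q \<theta> = q0 + lam * \<theta>"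
    and "(\<lambda>v. v) \<in> \<Phi>" and "(\<lambda>v. v\<^sup>2) \<in> \<Phi>"
    and "deterministic_model \<Phi> q I \<rho> g"
    and "stochastic_model \<Phi> q I f"
    and "\<And>\<theta>. \<theta> \<in> I \<Longrightarrow> law (\<lambda>v. f 0 v \<theta>) = law (g 0)"
    and "mean_value (g 0) = 0"
    and "energy (g 0) = 1"
    and "\<And>\<theta>. \<theta> \<in> I \<Longrightarrow> energy (\<lambda>v. f 0 v \<theta>) = 1"
  shows
    "(distr M borel \<Theta> = distr M borel (\<lambda>\<omega>. - \<Theta> \<omega>) \<and>
      integrable M (\<lambda>\<omega>. (\<Theta> \<omega>)\<^sup>2) \<and> 0 < prob_space.variance M \<Theta> \<longrightarrow>
        prob_space.expectation M \<Theta> = 0 \<and>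
        (\<forall>t\<ge>0. energy (g t) = exp (2 * (q0\<^sup>2 - q0 + lam\<^sup>2 * prob_space.variance M \<Theta>) * t)) \<and>
        (\<forall>t\<ge>0. \<forall>\<theta>\<in>I. energy (\<lambda>v. f t v \<theta>) =
           exp (2 * (q0\<^sup>2 - q0 + lam\<^sup>2 * \<theta>\<^sup>2 + lam * (2 * q0 - 1) * \<theta>) * t)) \<and>
        (lam < sqrt (q0 * (1 - q0) / prob_space.variance M \<Theta>) \<longrightarrow>
           ((\<lambda>t. W2 (law (g t)) (return borel 0)) \<longlongrightarrow> 0) at_top))
     \<and>
     (I = {-1..1} \<and> distr M lborel \<Theta> = uniform_measure lborel {-1..1} \<and>
      lam \<le> min q0 (1 - q0) \<longrightarrow>
        ((\<lambda>t. energy (averaged I \<rho> f t)) \<longlongrightarrow> 0) at_top \<and>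
        ((\<lambda>t. W2 (law (averaged I \<rho> f t)) (return borel 0)) \<longlongrightarrow> 0) at_top)
     \<and>
     (I = {-1..1} \<and> distr M lborel \<Theta> = uniform_measure lborel {-1..1} \<longrightarrow>
        prob_space.variance M \<Theta> = 1 / 3 \<and>
        (\<exists>C :: real \<Rightarrow> real. \<exists>c. c \<noteq> 0 \<and> (C \<longlongrightarrow> c) at_top \<and>
           (\<lambda>t. energy (averaged I \<rho> f t) / energy (g t)) \<sim>[at_top]
             (\<lambda>t. C t / t * exp (2 * (2 / 3 * lam\<^sup>2 + lam * \<bar>2 * q0 - 1\<bar>) * t))) \<and>
        (\<lambda>t. energy (g t)) \<in> o[at_top](\<lambda>t. energy (averaged I \<rho> f t)))"

proof -
  note \<Theta>I = assms(2) and Im = assms(3) and \<rho>0 = assms(4) and D = assms(5) and q0 = assms(6,7)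
    and lam = assms(8) and q = assms(9) and \<Phi> = assms(10,11) and det = assms(12) and sto = assms(13)
  interpret prob_space M by fact
  have [measurable]: "\<Theta> \<in> borel_measurable M"
    using distributed_measurable[OF D] by simp
  \<comment> \<open>\<open>P\<close> is \<open>(q \<theta>)\<^sup>2 - q \<theta>\<close> expanded in
    powers of \<theta>: half the growth rate of the energy at fixed \<theta>.\<close>
  define P where "P = (\<lambda>\<theta>. q0\<^sup>2 - q0 + lam\<^sup>2 * \<theta>\<^sup>2 + lam * (2 * q0 - 1) * \<theta>)"
  have [measurable]: "P \<in> borel_measurable borel"
    unfolding P_def by measurable
  have qP: "(q \<theta>)\<^sup>2 - q \<theta> = P \<theta>" for \<theta>
    by (simp add: q P_def power2_eq_square algebra_simps)

  \<comment> \<open>Energies of the two models\<close>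
  have gen: "prob_density (g t)" "integrable lborel (\<lambda>v. v\<^sup>2 * g t v)"
    if "0 \<le> t" for t
    using det that by (auto simp: deterministic_model_def)
  have Ef: "energy (\<lambda>v. f t v \<theta>) = exp (2 * P \<theta> * t)" if "0 \<le> t" "\<theta> \<in> I" for t \<theta>
  proof -
    have "prob_density (\<lambda>v. f 0 v \<theta>)"
      using sto \<open>\<theta> \<in> I\<close> by (auto simp: stochastic_model_def)
    then have "mean_value (\<lambda>v. f 0 v \<theta>) = 0"
      using mean_value_cong_law[OF _ gen(1)[OF order_refl] assms(14)[OF \<open>\<theta> \<in> I\<close>]] assms(15) by simp
    from energy_stochastic[OF sto \<Phi> \<open>\<theta> \<in> I\<close> this \<open>0 \<le> t\<close>] show ?thesis
      by (simp add: assms(17)[OF \<open>\<theta> \<in> I\<close>] qP)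
  qed
  \<comment> \<open>Averaging \<open>P\<close> removes the linear term, because the mean is zero,
    and turns the quadratic one into the variance. Only these two moments enter, so the formula
    serves symmetric and uniform laws alike.\<close>
  have Eg: "energy (g t) = exp (2 * (q0\<^sup>2 - q0 + lam\<^sup>2 * variance \<Theta>) * t)"
    if "integrable M (\<lambda>\<omega>. (\<Theta> \<omega>)\<^sup>2)" "expectation \<Theta> = 0" "0 \<le> t" for t
  proof -
    have i1: "integrable M \<Theta>"
      using square_integrable_imp_integrable[OF _ that(1)] by simp
    have "(LINT \<theta>:I|lborel. ((q \<theta>)\<^sup>2 - q \<theta>) * \<rho> \<theta>) = expectation (\<lambda>\<omega>. P (\<Theta> \<omega>))"
      using set_integral_distributed(1)[OF D \<rho>0 \<Theta>I Im, of P] by (simp add: qP mult.commute)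
    also have "\<dots> = q0\<^sup>2 - q0 + lam\<^sup>2 * variance \<Theta>"
      unfolding P_def using that i1 by (simp add: prob_space)
    finally show ?thesis
      using energy_deterministic[OF det \<Phi> assms(15) \<open>0 \<le> t\<close>] assms(16) by simp
  qed

  have exp_decay: "((\<lambda>t. exp (2 * k * t)) \<longlongrightarrow> 0) at_top" if "k < 0" for k :: real
    using that by real_asymp

  have exp_decay: "((\<lambda>t. exp (2 * k * t)) \<longlongrightarrow> 0) at_top" if "k < 0" for k :: real
    using that by real_asymp

  have exp_decay: "((\<lambda>t. exp (2 * k * t)) \<longlongrightarrow> 0) at_top" if "k < 0" for k :: real
    using that by real_asymp

  have exp_decay: "((\<lambda>t. exp (2 * k * t)) \<longlongrightarrow> 0) at_top" if "k < 0" for k :: real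
    using that by real_asymp

  have exp_decay: "((\<lambda>t. exp (2 * k * t)) \<longlongrightarrow> 0) at_top" if "k < 0" for k :: real
    using that by real_asymp

  have exp_decay: "((\<lambda>t. exp (2 * k * t)) \<longlongrightarrow> 0) at_top" if "k < 0" for k :: real
    using that by real_asymp

  \<comment> \<open>Symmetric parameter laws\<close>
  have part1: "expectation \<Theta> = 0 \<and>
        (\<forall>t\<ge>0. energy (g t) = exp (2 * (q0\<^sup>2 - q0 + lam\<^sup>2 * variance \<Theta>) * t)) \<and>
        (\<forall>t\<ge>0. \<forall>\<theta>\<in>I. energy (\<lambda>v. f t v \<theta>) =
           exp (2 * (q0\<^sup>2 - q0 + lam\<^sup>2 * \<theta>\<^sup>2 + lam * (2 * q0 - 1) * \<theta>) * t)) \<and>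
        (lam < sqrt (q0 * (1 - q0) / variance \<Theta>) \<longrightarrow>
           ((\<lambda>t. W2 (law (g t)) (return borel 0)) \<longlongrightarrow> 0) at_top)"
    if sym: "distr M borel \<Theta> = distr M borel (\<lambda>\<omega>. - \<Theta> \<omega>)"
      and sq: "integrable M (\<lambda>\<omega>. (\<Theta> \<omega>)\<^sup>2)" and var: "0 < variance \<Theta>"
  proof (intro conjI allI impI ballI)
    \<comment> \<open>Invariance of the law under reflection makes the expectation equal to its own
      negative.\<close>
    have "expectation \<Theta> = (\<integral>x. x \<partial>distr M borel \<Theta>)"
      by (simp add: integral_distr)
    also have "\<dots> = expectation (\<lambda>\<omega>. - \<Theta> \<omega>)"
      unfolding sym by (simp add: integral_distr)
    finally show mean: "expectation \<Theta> = 0" by simp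
    show "energy (g t) = exp (2 * (q0\<^sup>2 - q0 + lam\<^sup>2 * variance \<Theta>) * t)" if "0 \<le> t" for t
      using Eg[OF sq mean that] .
    show "energy (\<lambda>v. f t v \<theta>) = exp (2 * (q0\<^sup>2 - q0 + lam\<^sup>2 * \<theta>\<^sup>2 + lam * (2 * q0 - 1) * \<theta>) * t)"
      if "0 \<le> t" "\<theta> \<in> I" for t \<theta>
      using Ef[OF that] by (simp add: P_def)
    assume "lam < sqrt (q0 * (1 - q0) / variance \<Theta>)"
    then have "lam\<^sup>2 < q0 * (1 - q0) / variance \<Theta>"
      using lam by (metis abs_of_pos real_sqrt_abs real_sqrt_less_iff)
    then have neg: "q0\<^sup>2 - q0 + lam\<^sup>2 * variance \<Theta> < 0"
      using var by (simp add: pos_less_divide_eq power2_eq_square algebra_simps)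
    have "((\<lambda>t. exp (2 * (q0\<^sup>2 - q0 + lam\<^sup>2 * variance \<Theta>) * t)) \<longlongrightarrow> 0) at_top"
      using exp_decay[OF neg] .
    moreover have "\<forall>\<^sub>F t in at_top. exp (2 * (q0\<^sup>2 - q0 + lam\<^sup>2 * variance \<Theta>) * t) = energy (g t)"
      using eventually_ge_at_top[of 0] by eventually_elim (use Eg[OF sq mean] in simp)
    ultimately have "((\<lambda>t. energy (g t)) \<longlongrightarrow> 0) at_top"
      by (rule Lim_transform_eventually)
    then show "((\<lambda>t. W2 (law (g t)) (return borel 0)) \<longlongrightarrow> 0) at_top"
      using gen by (intro W2_tendsto_0) auto
  qed

  \<comment> \<open>Averaged energy under the uniform law\<close>
  \<comment> \<open>The maximum of the convex quadratic \<open>P\<close> over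
    \<open>{-1..1}\<close>, attained at an endpoint.\<close>
  define m where "m = q0\<^sup>2 - q0 + lam\<^sup>2 + lam * \<bar>2 * q0 - 1\<bar>"
  have uniform: "(\<forall>t\<ge>0. prob_density (averaged I \<rho> f t) \<and> integrable lborel (\<lambda>v. v\<^sup>2 * averaged I \<rho> f t v)) \<and>
     variance \<Theta> = 1 / 3 \<and>
     (\<forall>t\<ge>0. energy (g t) = exp (2 * (q0\<^sup>2 - q0 + lam\<^sup>2 * (1 / 3)) * t)) \<and>
     (\<exists>C c. 0 < c \<and> (C \<longlongrightarrow> c) at_top \<and> (\<forall>t>0. energy (averaged I \<rho> f t) = C t / t * exp (2 * m * t)))"
    if U: "I = {-1..1}" "distr M lborel \<Theta> = uniform_measure lborel {-1..1}"
  proof -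
    have UD: "distributed M lborel \<Theta> (\<lambda>x. indicator {-1..1} x / measure lborel {-1..1::real})"
      using U(2) by (intro uniform_distributedI) auto
    have var: "variance \<Theta> = 1 / 3" and mean: "expectation \<Theta> = 0"
      using uniform_distributed_variance[OF UD] uniform_distributed_expectation[OF UD] by simp_all
    have sq: "integrable M (\<lambda>\<omega>. (\<Theta> \<omega>)\<^sup>2)"
      by (rule uniform_expectation_continuous(1)[OF UD]) (auto intro!: continuous_intros)
    have contP: "continuous_on UNIV (\<lambda>\<theta>. exp (2 * P \<theta> * t))" for t
      unfolding P_def by (intro continuous_intros)
    note uni = uniform_expectation_continuous[OF UD _ contP]
    \<comment> \<open>The average is taken against \<open>\<rho>\<close>, which is known only as
      some density of the law of \<open>\<Theta>\<close>. It is therefore first written as an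
      expectation on \<open>M\<close>, which \<open>uni\<close> then evaluates as an integral over
      \<open>{-1..1}\<close>.\<close>
    note avg = averaged_stochastic_model[OF prob_space_axioms D \<rho>0 \<Theta>I Im sto _ _ Ef uni(1)]
    define A where "A = 2 * lam\<^sup>2"
    define B where "B = 2 * lam * (2 * q0 - 1)"
    have Bm: "2 * (q0\<^sup>2 - q0) + (A + \<bar>B\<bar>) = 2 * m"
      using lam by (simp add: A_def B_def m_def abs_mult)
    \<comment> \<open>Chosen so that the averaged energy equals
      \<open>C t / t * exp (2 * m * t)\<close> exactly for \<open>t > 0\<close>, with no error term.
      The divisor 2 is the length of the interval; \<open>A\<close> and \<open>B\<close> are the
      coefficients of \<open>2 * P\<close>.\<close>
    define C where "C = (\<lambda>t. t * exp (- (A + \<bar>B\<bar>) * t) * integral {-1..1} (\<lambda>s. exp (t * (A * s\<^sup>2 + B * s))) / 2)"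
    have "0 < A" using lam by (simp add: A_def)
    then obtain c where c: "0 < c"
      "((\<lambda>t. t * exp (- (A + \<bar>B\<bar>) * t) * integral {-1..1} (\<lambda>s. exp (t * (A * s\<^sup>2 + B * s)))) \<longlongrightarrow> c) at_top"
      using laplace_two_endpoints[of A B] by blast
    have C: "(C \<longlongrightarrow> c / 2) at_top"
      unfolding C_def by (intro tendsto_divide c(2) tendsto_const) simp
    have "energy (averaged I \<rho> f t) = C t / t * exp (2 * m * t)" if "0 < t" for t
    proof -
      have "energy (averaged I \<rho> f t) = integral {-1..1} (\<lambda>\<theta>. exp (2 * P \<theta> * t)) / 2"
        using avg(3)[of t] uni(2)[of t] that by simp
      also have "integral {-1..1} (\<lambda>\<theta>. exp (2 * P \<theta> * t))
          = integral {-1..1} (\<lambda>\<theta>. exp (2 * (q0\<^sup>2 - q0) * t) * exp (t * (A * \<theta>\<^sup>2 + B * \<theta>)))"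
        by (rule Henstock_Kurzweil_Integration.integral_cong)
          (auto simp: P_def A_def B_def algebra_simps simp flip: exp_add)
      also have "\<dots> = exp (2 * (q0\<^sup>2 - q0) * t) * integral {-1..1} (\<lambda>\<theta>. exp (t * (A * \<theta>\<^sup>2 + B * \<theta>)))"
        by (rule Henstock_Kurzweil_Integration.integral_mult_right)
      also have "exp (2 * (q0\<^sup>2 - q0) * t) = exp (- (A + \<bar>B\<bar>) * t) * exp (2 * m * t)"
        unfolding Bm[symmetric] by (simp add: algebra_simps flip: exp_add)
      finally show ?thesis
        using that by (simp add: C_def)
    qed
    moreover have "prob_density (averaged I \<rho> f t)" "integrable lborel (\<lambda>v. v\<^sup>2 * averaged I \<rho> f t v)"
      if "0 \<le> t" for t
      using avg(1,2)[of t] that by simp_all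
    moreover have "energy (g t) = exp (2 * (q0\<^sup>2 - q0 + lam\<^sup>2 * (1 / 3)) * t)" if "0 \<le> t" for t
      using Eg[OF sq mean that] unfolding var .
    moreover have "0 < c / 2" using c(1) by simp
    ultimately show ?thesis
      using C var by blast
  qed

  \<comment> \<open>Consensus in the averaged stochastic model\<close>
  have part2: "((\<lambda>t. energy (averaged I \<rho> f t)) \<longlongrightarrow> 0) at_top \<and>
        ((\<lambda>t. W2 (law (averaged I \<rho> f t)) (return borel 0)) \<longlongrightarrow> 0) at_top"
    if U: "I = {-1..1}" "distr M lborel \<Theta> = uniform_measure lborel {-1..1}" and le: "lam \<le> min q0 (1 - q0)"
  proof -
    obtain C c where C: "(C \<longlongrightarrow> c) at_top"
      "\<And>t. 0 < t \<Longrightarrow> energy (averaged I \<rho> f t) = C t / t * exp (2 * m * t)"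
      using uniform[OF U] by blast
    \<comment> \<open>The two candidates are the values of \<open>P\<close> at \<open>1\<close> and
      \<open>-1\<close>, according to the sign of \<open>2 * q0 - 1\<close>.\<close>
    have "m = (q0 + lam) * (q0 + lam - 1) \<or> m = (q0 - lam) * (q0 - lam - 1)"
      unfolding m_def by (auto simp: abs_if power2_eq_square algebra_simps)
    moreover have "(q0 + lam) * (q0 + lam - 1) \<le> 0" "(q0 - lam) * (q0 - lam - 1) \<le> 0"
      using le lam q0 by (auto intro!: mult_nonneg_nonpos)
    ultimately have m: "m \<le> 0" by auto
    \<comment> \<open>For \<open>lam = min q0 (1 - q0)\<close> the exponent \<open>m\<close> is 0,
      so decay has to come from the factor \<open>1 / t\<close>.\<close>
    have "((\<lambda>t. C t / t) \<longlongrightarrow> 0) at_top"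
      using C(1) by (rule tendsto_divide_0) (auto intro: filterlim_at_top_imp_at_infinity filterlim_ident)
    then have "((\<lambda>t. \<bar>C t / t\<bar>) \<longlongrightarrow> 0) at_top"
      by (rule tendsto_rabs_zero)
    moreover have "\<forall>\<^sub>F t in at_top. norm (energy (averaged I \<rho> f t)) \<le> \<bar>C t / t\<bar>"
      using eventually_gt_at_top[of 0]
    proof eventually_elim
      case (elim t)
      then have "exp (2 * m * t) \<le> 1" using m by (simp add: mult_le_0_iff)
      then have "\<bar>C t / t\<bar> * exp (2 * m * t) \<le> \<bar>C t / t\<bar>" by (intro mult_left_le) auto
      then show ?case using C(2)[OF elim] by (simp add: abs_mult)
    qed
    ultimately have "((\<lambda>t. energy (averaged I \<rho> f t)) \<longlongrightarrow> 0) at_top"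
      by (rule Lim_null_comparison[rotated])
    then show ?thesis
      using uniform[OF U] by (auto intro!: W2_tendsto_0)
  qed

  \<comment> \<open>Comparison of the two energies\<close>
  have part3: "variance \<Theta> = 1 / 3 \<and>
        (\<exists>C :: real \<Rightarrow> real. \<exists>c. c \<noteq> 0 \<and> (C \<longlongrightarrow> c) at_top \<and>
           (\<lambda>t. energy (averaged I \<rho> f t) / energy (g t)) \<sim>[at_top]
             (\<lambda>t. C t / t * exp (2 * (2 / 3 * lam\<^sup>2 + lam * \<bar>2 * q0 - 1\<bar>) * t))) \<and>
        (\<lambda>t. energy (g t)) \<in> o[at_top](\<lambda>t. energy (averaged I \<rho> f t))"
    if U: "I = {-1..1}" "distr M lborel \<Theta> = uniform_measure lborel {-1..1}"
  proof -
    \<comment> \<open>The gap between \<open>m\<close> and the corresponding constant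
      \<open>q0\<^sup>2 - q0 + lam\<^sup>2 / 3\<close> of the deterministic energy. It is positive
      because \<open>lam > 0\<close>.\<close>
    define K where "K = 2 / 3 * lam\<^sup>2 + lam * \<bar>2 * q0 - 1\<bar>"
    have K: "0 < K" using lam by (auto simp: K_def intro!: add_pos_nonneg)
    obtain C c where C: "0 < c" "(C \<longlongrightarrow> c) at_top"
      "\<And>t. 0 < t \<Longrightarrow> energy (averaged I \<rho> f t) = C t / t * exp (2 * m * t)"
      using uniform[OF U] by blast
    have g: "\<And>t. 0 \<le> t \<Longrightarrow> energy (g t) = exp (2 * (q0\<^sup>2 - q0 + lam\<^sup>2 * (1 / 3)) * t)"
      and var: "variance \<Theta> = 1 / 3"
      using uniform[OF U] by auto
    have mK: "exp (2 * m * t) = exp (2 * K * t) * exp (2 * (q0\<^sup>2 - q0 + lam\<^sup>2 * (1 / 3)) * t)" for t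
      by (simp add: m_def K_def algebra_simps flip: exp_add)
    have ratio: "energy (averaged I \<rho> f t) / energy (g t) = C t / t * exp (2 * K * t)" if "0 < t" for t
      using that C(3)[OF that] g[of t] mK[of t] by simp
    \<comment> \<open>For \<open>t > 0\<close> the two sides coincide, so the equivalence is
      reflexivity up to eventual equality.\<close>
    have "(\<lambda>t. energy (averaged I \<rho> f t) / energy (g t)) \<sim>[at_top] (\<lambda>t. C t / t * exp (2 * K * t))"
      by (intro asymp_equiv_refl_ev eventually_mono[OF eventually_gt_at_top[of 0]] ratio)
    moreover have "(\<lambda>t. energy (g t)) \<in> o[at_top](\<lambda>t. energy (averaged I \<rho> f t))"
    proof (rule smalloI_tendsto)
      have Cpos: "\<forall>\<^sub>F t in at_top. 0 < C t"
        using order_tendstoD(1)[OF C(2,1)] .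
      show "\<forall>\<^sub>F t in at_top. energy (averaged I \<rho> f t) \<noteq> 0"
        using Cpos eventually_gt_at_top[of 0] by eventually_elim (simp add: C(3))
      \<comment> \<open>This is the reciprocal ratio without \<open>C\<close>. Since
        \<open>C\<close> tends to \<open>c > 0\<close>, dividing by it preserves the limit
        0.\<close>
      have "((\<lambda>t. t * exp (- 2 * K * t)) \<longlongrightarrow> 0) at_top"
        using K by real_asymp
      from tendsto_divide[OF this C(2)] C(1)
      have "((\<lambda>t. t * exp (- 2 * K * t) / C t) \<longlongrightarrow> 0) at_top" by simp
      moreover have "\<forall>\<^sub>F t in at_top. t * exp (- 2 * K * t) / C t = energy (g t) / energy (averaged I \<rho> f t)"
        using eventually_gt_at_top[of 0]
      proof eventually_elim
        case (elim t)
        have "energy (g t) / energy (averaged I \<rho> f t) = 1 / (C t / t * exp (2 * K * t))"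
          unfolding ratio[OF elim, symmetric] by simp
        then show ?case by (simp add: exp_minus field_simps)
      qed
      ultimately show "((\<lambda>t. energy (g t) / energy (averaged I \<rho> f t)) \<longlongrightarrow> 0) at_top"
        by (rule Lim_transform_eventually)
    qed
    ultimately show ?thesis
      using C(1,2) var unfolding K_def by (intro conjI exI[of _ C] exI[of _ c]) auto
  qed

  show ?thesis
    using part1 part2 part3 by blast
qed

end
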